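(* Let $(E,w)$ be a sink-separated weighted graph, and let $\widetilde E$ and $F$ be its associated auxiliary graph and $\mathcal P2$-graph, respectively. Then $F$ is acyclic if and only if the following two conditions hold: (AC) $E$ is acyclic; (CE2) no cycle in $\widetilde E$ contains a bar edge.
   Context: A directed graph is $E=(E^0,E^1,s,r)$; $v\in E^0$ is a sink if $s^{-1}(v)=\varnothing$. A cycle is a sequence of edges $e_1\cdots e_n$, $n\ge1$, with $r(e_i)=s(e_{i+1})$, $r(e_n)=s(e_1)$ and the vertices $s(e_i)$ pairwise distinct; a graph is acyclic if it has no cycles. A weighted graph $(E,w)$ is a directed graph with a map $w:E^1\to\{1,2,\dots\}$; standing assumption: nonempty, row-finite ($|s^{-1}(v)|<\infty$ for all $v$), connected. $E_w=\{e:w(e)>1\}$ is the set of weighted edges and $E_{uw}=\{e:w(e)=1\}$ the set of unweighted edges. $(E,w)$ is sink-separated if every weighted edge has range a sink of $E$, and no two distinct weighted edges have the same source or the same range. For $v\in r(E_w)$ let $g^v$ be the unique weighted edge with range $v$. Auxiliary graph $\widetilde E$: the directed graph with vertex set $E^0$ whose edges are the unweighted edges $e\in E_{uw}$ (same source and range as in $E$) together with, for each weighted edge $g\in E_w$, a bar edge $\overline g$ with source $r(g)$ and range $s(g)$. $\mathcal P2$-graph $F$ of a sink-separated $(E,w)$: the (unweighted) directed graph with vertices $E^0\setminus r(E_w)$ together with $v^{(1)},\dots,v^{(w(g^v))}$ for each $v\in r(E_w)$, and edges: each $e\in E_{uw}$ with $r(e)\notin r(E_w)$, with unchanged source and range;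 for each $e\in E_{uw}$ with $r(e)=v\in r(E_w)$, edges $e^{(i)}$ from $s(e)$ to $v^{(i)}$ for $1\le i\le w(g^v)$; for each $e\in E_w$, an edge $e^{(1)}$ from $s(e)$ to $r(e)^{(1)}$ and edges $e^{(i)}$ from $r(e)^{(i)}$ to $s(e)$ for $2\le i\le w(e)$. *)

theory Defs
  imports "Graph_Theory.Digraph_Component"
begin

text \<open>
  A directed graph \<open>(E\<^sup>0, E\<^sup>1, s, r)\<close> is a \<^type>\<open>pre_digraph\<close> satisfying \<^locale>\<open>wf_digraph\<close>,
  with \<open>s\<close> = \<^const>\<open>tail\<close> and \<open>r\<close> = \<^const>\<open>head\<close>; loops, parallel edges and infinitely many
  vertices are allowed. The library's \<^const>\<open>pre_digraph.cycle\<close> asks for distinct entries in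
  \<open>r(e\<^sub>1), \<dots>, r(e\<^sub>n)\<close>; for a closed walk this list is a rotation of \<open>s(e\<^sub>1), \<dots>, s(e\<^sub>n)\<close>.
\<close>

definition acyclic_digraph :: "('v, 'e) pre_digraph \<Rightarrow> bool" where
  "acyclic_digraph E \<longleftrightarrow> \<not> (\<exists>p. pre_digraph.cycle E p)"

definition sink :: "('v, 'e) pre_digraph \<Rightarrow> 'v \<Rightarrow> bool" where
  "sink E v \<longleftrightarrow> v \<in> verts E \<and> out_arcs E v = {}"

text \<open>
  \<^const>\<open>connected\<close> refers to the underlying undirected graph and includes that
  there is at least one vertex.
\<close>

locale weighted_graph = wf_digraph E for E :: "('v, 'e) pre_digraph" (structure) +
  fixes w :: "'e \<Rightarrow> nat"
  assumes weight_pos: "e \<in> arcs E \<Longrightarrow> w e \<ge> 1"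
    and row_finite: "v \<in> verts E \<Longrightarrow> finite (out_arcs E v)"
    and connected: "connected E"

definition weighted_arcs :: "('v, 'e) pre_digraph \<Rightarrow> ('e \<Rightarrow> nat) \<Rightarrow> 'e set" where
  "weighted_arcs E w = {e \<in> arcs E. w e > 1}"

definition unweighted_arcs :: "('v, 'e) pre_digraph \<Rightarrow> ('e \<Rightarrow> nat) \<Rightarrow> 'e set" where
  "unweighted_arcs E w = {e \<in> arcs E. w e = 1}"

locale sink_separated = weighted_graph +
  assumes head_sink: "e \<in> weighted_arcs E w \<Longrightarrow> sink E (head E e)"
    and tail_inj: "inj_on (tail E) (weighted_arcs E w)"
    and head_inj: "inj_on (head E) (weighted_arcs E w)"

text \<open>The edge \<open>g\<^sup>v\<close>, meaningful for \<open>v\<close> in \<open>r(E\<^sub>w)\<close>.\<close>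

definition weighted_arc_to :: "('v, 'e) pre_digraph \<Rightarrow> ('e \<Rightarrow> nat) \<Rightarrow> 'v \<Rightarrow> 'e" where
  "weighted_arc_to E w v = (THE g. g \<in> weighted_arcs E w \<and> head E g = v)"

datatype 'e tilde_arc = Plain 'e | Bar 'e

definition tilde_graph ::
  "('v, 'e) pre_digraph \<Rightarrow> ('e \<Rightarrow> nat) \<Rightarrow> ('v, 'e tilde_arc) pre_digraph" where
  "tilde_graph E w = \<lparr>
     verts = verts E,
     arcs = Plain ` unweighted_arcs E w \<union> Bar ` weighted_arcs E w,
     tail = (\<lambda>a. case a of Plain e \<Rightarrow> tail E e | Bar g \<Rightarrow> head E g),
     head = (\<lambda>a. case a of Plain e \<Rightarrow> head E e | Bar g \<Rightarrow> tail E g)\<rparr>"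

text \<open>\<open>Copy x i\<close> stands for \<open>x\<^sup>(\<^sup>i\<^sup>)\<close>, and \<open>Old x\<close> for an unchanged vertex or edge \<open>x\<close>.\<close>

datatype 'a p2 = Old 'a | Copy 'a nat

definition p2_graph ::
  "('v, 'e) pre_digraph \<Rightarrow> ('e \<Rightarrow> nat) \<Rightarrow> ('v p2, 'e p2) pre_digraph" where
  "p2_graph E w = (let Ew = weighted_arcs E w; Euw = unweighted_arcs E w; R = head E ` Ew in \<lparr>
     verts = Old ` (verts E - R)
       \<union> {Copy v i | v i. v \<in> R \<and> 1 \<le> i \<and> i \<le> w (weighted_arc_to E w v)},
     arcs = {Old e | e. e \<in> Euw \<and> head E e \<notin> R}
       \<union> {Copy e i | e i. e \<in> Euw \<and> head E e \<in> R \<and> 1 \<le> i \<and> i \<le> w (weighted_arc_to E w (head E e))}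
       \<union> {Copy e i | e i. e \<in> Ew \<and> 1 \<le> i \<and> i \<le> w e},
     tail = (\<lambda>a. case a of
         Old e \<Rightarrow> Old (tail E e)
       | Copy e i \<Rightarrow> if e \<in> Ew \<and> i \<ge> 2 then Copy (head E e) i else Old (tail E e)),
     head = (\<lambda>a. case a of
         Old e \<Rightarrow> Old (head E e)
       | Copy e i \<Rightarrow> if e \<in> Ew \<and> i \<ge> 2 then Old (tail E e) else Copy (head E e) i)\<rparr>)"

text \<open>Both constructions yield directed graphs.\<close>

lemma (in weighted_graph) wf_tilde_graph: "wf_digraph (tilde_graph E w)"
  by unfold_locales
    (auto simp: tilde_graph_def weighted_arcs_def unweighted_arcs_def)

lemma (in sink_separated) weighted_arc_to_head:
  "g \<in> weighted_arcs E w \<Longrightarrow> weighted_arc_to E w (head E g) = g"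
  unfolding weighted_arc_to_def using head_inj by (auto dest: inj_onD)

lemma (in sink_separated) tail_not_weighted_head:
  "e \<in> arcs E \<Longrightarrow> tail E e \<notin> head E ` weighted_arcs E w"
  using head_sink by (force simp: sink_def out_arcs_def)

lemma (in sink_separated) wf_p2_graph: "wf_digraph (p2_graph E w)"
proof
  fix a assume a: "a \<in> arcs (p2_graph E w)"
  show "tail (p2_graph E w) a \<in> verts (p2_graph E w)"
    using a tail_not_weighted_head
    by (auto simp: p2_graph_def Let_def weighted_arc_to_head weighted_arcs_def unweighted_arcs_def)
  show "head (p2_graph E w) a \<in> verts (p2_graph E w)"
    using a tail_not_weighted_head
    by (auto simp: p2_graph_def Let_def weighted_arc_to_head weighted_arcs_def unweighted_arcs_def)
qed

end

theory Submission
  imports Defs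
begin

text \<open>
  Both sides of the equivalence say that \<open>\<E> = tilde_graph E w\<close> has no cycle.

  Sinks never lie on cycles. Weighted edges of \<open>E\<close> end in sinks, so cycles of \<open>E\<close> are exactly the
  cycles of \<open>\<E>\<close> without bar edges. Hence the two conditions on the right say together that \<open>\<E>\<close> is
  acyclic.

  On the left, let \<open>F\<close> be the \<open>\<P>2\<close>-graph. Forgetting the superscripts sends
  an unweighted edge of \<open>F\<close> to a plain edge of \<open>\<E>\<close> and \<open>g\<^sup>(\<^sup>i\<^sup>)\<close>, for weighted \<open>g\<close> and \<open>i \<ge> 2\<close>, to
  the bar edge of \<open>g\<close>. Only the edges \<open>g\<^sup>(\<^sup>1\<^sup>)\<close> have no image, and these end in the vertices
  \<open>r(g)\<^sup>(\<^sup>1\<^sup>)\<close>, which are sinks of \<open>F\<close>. In the other direction, choosing the copy \<open>v\<^sup>(\<^sup>2\<^sup>)\<close> of every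
  \<open>v\<close> in \<open>r(E\<^sub>w)\<close> embeds \<open>\<E>\<close> into \<open>F\<close>, as \<open>w(g) \<ge> 2\<close> for weighted \<open>g\<close>. So \<open>F\<close> is acyclic iff
  \<open>\<E>\<close> is.
\<close>

lemma (in wf_digraph) acyclic_digraph_iff_reachable1:
  "acyclic_digraph G \<longleftrightarrow> (\<forall>u. \<not> u \<rightarrow>\<^sup>+ u)"
proof
  assume "acyclic_digraph G"
  then show "\<forall>u. \<not> u \<rightarrow>\<^sup>+ u"
    using closed_w_imp_cycle by (auto simp: acyclic_digraph_def closed_w_def reachable1_awalk)
next
  assume "\<forall>u. \<not> u \<rightarrow>\<^sup>+ u"
  then show "acyclic_digraph G"
    by (auto simp: acyclic_digraph_def cycle_def reachable1_awalk)
qed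

text \<open>
  Every arc on a closed walk is followed by another arc. A vertex map therefore transports closed
  walks as soon as it preserves the arcs that can be prolonged, whatever it does to arcs into sinks.
\<close>

lemma acyclic_digraph_vertex_map:
  fixes f :: "'a \<Rightarrow> 'c"
  assumes "wf_digraph G" and "wf_digraph H"
    and arc: "\<And>a b. \<lbrakk>a \<in> arcs G; b \<in> arcs G; tail G b = head G a\<rbrakk>
      \<Longrightarrow> \<exists>c \<in> arcs H. tail H c = f (tail G a) \<and> head H c = f (head G a)"
    and acyclic: "acyclic_digraph H"
  shows "acyclic_digraph G"
proof -
  interpret G: wf_digraph G by fact
  interpret H: wf_digraph H by fact
  have arc_image: "f x \<rightarrow>\<^bsub>H\<^esub> f y" if "x \<rightarrow>\<^bsub>G\<^esub> y" "y \<rightarrow>\<^bsub>G\<^esub> z" for x y z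
  proof -
    from that obtain a b where
      "a \<in> arcs G" "tail G a = x" "head G a = y" "b \<in> arcs G" "tail G b = y"
      by (auto simp: arcs_ends_def arc_to_ends_def)
    then obtain c where "c \<in> arcs H" "tail H c = f x" "head H c = f y"
      using arc by blast
    then show ?thesis using H.in_arcs_imp_in_arcs_ends by metis
  qed
  have walk: "f x \<rightarrow>\<^sup>+\<^bsub>H\<^esub> f y" if "x \<rightarrow>\<^sup>+\<^bsub>G\<^esub> y" "y \<rightarrow>\<^bsub>G\<^esub> z" for x y z
    using that
  proof (induction arbitrary: z rule: trancl_induct)
    case (base y)
    then show ?case using arc_image by blast
  next
    case (step y y')
    then show ?case using arc_image by (meson trancl.trancl_into_trancl)
  qed
  have False if "u \<rightarrow>\<^sup>+\<^bsub>G\<^esub> u" for u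
  proof -
    from that obtain z where "u \<rightarrow>\<^bsub>G\<^esub> z" by (meson tranclD)
    with that have "f u \<rightarrow>\<^sup>+\<^bsub>H\<^esub> f u" by (rule walk)
    then show False using acyclic by (simp add: H.acyclic_digraph_iff_reachable1)
  qed
  then show ?thesis by (auto simp: G.acyclic_digraph_iff_reachable1)
qed

lemma (in weighted_graph) unweighted_arcs_eq:
  "unweighted_arcs E w = arcs E - weighted_arcs E w"
  using weight_pos by (force simp: unweighted_arcs_def weighted_arcs_def)

lemma tilde_graph_cycle_Plain:
  "pre_digraph.cycle (tilde_graph E w) (map Plain p)
    \<longleftrightarrow> pre_digraph.cycle E p \<and> set p \<subseteq> unweighted_arcs E w"
proof -
  have "pre_digraph.cas (tilde_graph E w) u (map Plain p) v \<longleftrightarrow> pre_digraph.cas E u p v" for u v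
    by (induction p arbitrary: u) (auto simp: pre_digraph.cas.simps tilde_graph_def)
  moreover have "pre_digraph.awalk_verts (tilde_graph E w) u (map Plain p)
      = pre_digraph.awalk_verts E u p" for u
    by (induction p arbitrary: u) (auto simp: pre_digraph.awalk_verts.simps tilde_graph_def)
  moreover have "set (map Plain p) \<subseteq> arcs (tilde_graph E w) \<longleftrightarrow> set p \<subseteq> unweighted_arcs E w"
    by (auto simp: tilde_graph_def)
  moreover have "unweighted_arcs E w \<subseteq> arcs E" by (auto simp: unweighted_arcs_def)
  moreover have "verts (tilde_graph E w) = verts E" by (simp add: tilde_graph_def)
  ultimately show ?thesis
    unfolding pre_digraph.cycle_def pre_digraph.awalk_def by fastforce
qed

context sink_separated
begin

lemma acyclic_tilde_graph_iff:
  "acyclic_digraph (tilde_graph E w) \<longleftrightarrow>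
    acyclic_digraph E \<and> \<not> (\<exists>p g. pre_digraph.cycle (tilde_graph E w) p \<and> Bar g \<in> set p)"
proof (intro iffI conjI)
  assume acyclic: "acyclic_digraph (tilde_graph E w)"
  show "acyclic_digraph E"
  proof (rule acyclic_digraph_vertex_map[OF _ wf_tilde_graph _ acyclic])
    show "wf_digraph E" by unfold_locales
    fix a b assume ab: "a \<in> arcs E" "b \<in> arcs E" "tail E b = head E a"
    then have "a \<in> unweighted_arcs E w"
      using head_sink by (force simp: unweighted_arcs_eq sink_def out_arcs_def)
    then show "\<exists>c \<in> arcs (tilde_graph E w). tail (tilde_graph E w) c = id (tail E a)
        \<and> head (tilde_graph E w) c = id (head E a)"
      by (intro bexI[of _ "Plain a"]) (auto simp: tilde_graph_def)
  qed
  show "\<not> (\<exists>p g. pre_digraph.cycle (tilde_graph E w) p \<and> Bar g \<in> set p)"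
    using acyclic by (auto simp: acyclic_digraph_def)
next
  assume conds: "acyclic_digraph E \<and>
    \<not> (\<exists>p g. pre_digraph.cycle (tilde_graph E w) p \<and> Bar g \<in> set p)"
  show "acyclic_digraph (tilde_graph E w)"
    unfolding acyclic_digraph_def
  proof
    assume "\<exists>p. pre_digraph.cycle (tilde_graph E w) p"
    then obtain p where p: "pre_digraph.cycle (tilde_graph E w) p" ..
    with conds have "set p \<subseteq> range Plain"
      by (metis tilde_arc.exhaust rangeI subsetI)
    then obtain q where "p = map Plain q"
      by (metis ex_map_conv rangeE subsetD)
    with p have "pre_digraph.cycle E q" by (simp add: tilde_graph_cycle_Plain)
    with conds show False by (auto simp: acyclic_digraph_def)
  qed
qed

lemma acyclic_p2_graph_if_acyclic_tilde_graph:
  assumes "acyclic_digraph (tilde_graph E w)"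
  shows "acyclic_digraph (p2_graph E w)"
proof (rule acyclic_digraph_vertex_map[OF wf_p2_graph wf_tilde_graph _ assms])
  let ?f = "\<lambda>x. case x of Old v \<Rightarrow> v | Copy v i \<Rightarrow> v"
  fix a b assume a: "a \<in> arcs (p2_graph E w)" and b: "b \<in> arcs (p2_graph E w)"
    and ab: "tail (p2_graph E w) b = head (p2_graph E w) a"
  \<comment> \<open>A weighted edge has index at least 2 here: nothing leaves the vertices \<open>v\<^sup>(\<^sup>1\<^sup>)\<close>.\<close>
  consider (plain) e where "e \<in> unweighted_arcs E w" "a = Old e \<or> (\<exists>i. a = Copy e i)"
    | (bar) e i where "e \<in> weighted_arcs E w" "i \<ge> 2" "a = Copy e i"
    using a b ab by (fastforce simp: p2_graph_def Let_def split: if_splits)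
  then show "\<exists>c \<in> arcs (tilde_graph E w). tail (tilde_graph E w) c = ?f (tail (p2_graph E w) a)
      \<and> head (tilde_graph E w) c = ?f (head (p2_graph E w) a)"
  proof cases
    case plain
    then show ?thesis
      by (intro bexI[of _ "Plain e"])
        (auto simp: p2_graph_def Let_def tilde_graph_def unweighted_arcs_eq)
  next
    case bar
    then show ?thesis
      by (intro bexI[of _ "Bar e"]) (auto simp: p2_graph_def Let_def tilde_graph_def)
  qed
qed

lemma acyclic_tilde_graph_if_acyclic_p2_graph:
  assumes "acyclic_digraph (p2_graph E w)"
  shows "acyclic_digraph (tilde_graph E w)"
proof (rule acyclic_digraph_vertex_map[OF wf_tilde_graph wf_p2_graph _ assms])
  let ?R = "head E ` weighted_arcs E w"
  \<comment> \<open>The copy with index 2 always exists, and unlike the first one it is the source of an edge.\<close>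
  let ?f = "\<lambda>v. if v \<in> ?R then Copy v 2 else Old v"
  fix a assume a: "a \<in> arcs (tilde_graph E w)"
  then consider (old) e where "a = Plain e" "e \<in> unweighted_arcs E w" "head E e \<notin> ?R"
    | (copy) e where "a = Plain e" "e \<in> unweighted_arcs E w" "head E e \<in> ?R"
    | (bar) g where "a = Bar g" "g \<in> weighted_arcs E w"
    by (auto simp: tilde_graph_def)
  then show "\<exists>c \<in> arcs (p2_graph E w). tail (p2_graph E w) c = ?f (tail (tilde_graph E w) a)
      \<and> head (p2_graph E w) c = ?f (head (tilde_graph E w) a)"
  proof cases
    case old
    moreover have "tail E e \<notin> ?R"
      using old tail_not_weighted_head by (auto simp: unweighted_arcs_def)
    ultimately show ?thesis
      by (intro bexI[of _ "Old e"]) (auto simp: p2_graph_def Let_def tilde_graph_def)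
  next
    case copy
    moreover have "tail E e \<notin> ?R"
      using copy tail_not_weighted_head by (auto simp: unweighted_arcs_def)
    moreover have "2 \<le> w (weighted_arc_to E w (head E e))"
      using copy(3) by (auto simp: weighted_arc_to_head weighted_arcs_def)
    moreover have "e \<notin> weighted_arcs E w"
      using copy(2) by (simp add: unweighted_arcs_eq)
    ultimately show ?thesis
      by (intro bexI[of _ "Copy e 2"]) (auto simp: p2_graph_def Let_def tilde_graph_def)
  next
    case bar
    moreover have "tail E g \<notin> ?R"
      using bar tail_not_weighted_head by (auto simp: weighted_arcs_def)
    moreover have "2 \<le> w g" using bar(2) by (auto simp: weighted_arcs_def)
    ultimately show ?thesis
      by (intro bexI[of _ "Copy g 2"]) (auto simp: p2_graph_def Let_def tilde_graph_def)
  qed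
qed

end

theorem corollary4p14:
  fixes E :: "('v, 'e) pre_digraph" and w :: "'e \<Rightarrow> nat"
  assumes "sink_separated E w"
  shows "acyclic_digraph (p2_graph E w) \<longleftrightarrow>
    acyclic_digraph E \<and>
    \<not> (\<exists>p g. pre_digraph.cycle (tilde_graph E w) p \<and> Bar g \<in> set p)"
proof -
  interpret sink_separated E w by fact
  show ?thesis
    using acyclic_p2_graph_if_acyclic_tilde_graph acyclic_tilde_graph_if_acyclic_p2_graph
      acyclic_tilde_graph_iff by blast
qed

end
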